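(* Consider the kinetic scheme (KS) defined in the context, with $u_b\ge\alpha$ for some constant $\alpha>0$. As long as $u_i^n>0$ for all $i$, if at each step $\Delta x^n$ satisfies the CFL type condition $$(\|h\|_\infty+2\|a\|_\infty)\,\Delta x^n\le \min_i(u_i^n)\,\Delta t,$$ then the following $L^\infty$ estimates hold: $$0\le\phi_i^n\le 1,\qquad 0\le c_i^n\le\max\{\|c_b\|_\infty,\|c_0\|_\infty\}\le 1 .$$ (That is: if $u_i^k>0$ for all $i$ and the CFL condition holds for all steps $k\le n$, then the estimates hold for all computed quantities up to step $n+1$.) The norms $\|h\|_\infty,\|a\|_\infty$ are taken on $[0,1]$.
   Context: Isotherms: $q_1,q_2:[0,1]\to\mathbb{R}$ are continuously differentiable, $q_1'\ge0\ge q_2'$, $h=q_1+q_2\ge0$, $f(c)=q_1(c)-c\,h(c)$, $a(\xi)=1+f'(\xi)$ on $[0,1]$. Put $a^+=\max(a,0)$, $a^-=-\min(a,0)$, $A^\pm(c)=\int_0^c a^\pm(\xi)\,d\xi$, and $\chi(c,\xi)=1$ if $0<\xi<c$, $0$ otherwise. Data: $c_b,c_0:(0,\infty)\to[0,1]$ and $u_b:(0,\infty)\to(0,\infty)$ bounded, measurable. The scheme approximates the system $\partial_x(uc)+\partial_t(c+q_1(c))=0$, $\partial_xu+\partial_th(c)=0$ with $c(t,0)=c_b(t)$, $u(t,0)=u_b(t)$, $c(0,x)=c_0(x)$; $x$ is the evolution variable. Mesh: $\Delta t>0$; temporal cells $Te_i=(t_{i-1/2},t_{i+1/2})$ of length $\Delta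 t$, $i\ge1$, $t_{1/2}=0$; $x_0=0$, $x_{n+1}=x_n+\Delta x^n$ with $\Delta x^n>0$ chosen at each step. Scheme (KS): initial and boundary values $$c_0^n=\frac1{\Delta x^n}\int_{x_n}^{x_{n+1}}c_0(x)\,dx\ (n\ge0),\qquad u_i^0=\frac1{\Delta t}\int_{Te_i}u_b\,dt,\quad c_i^0=\frac1{\Delta t}\int_{Te_i}c_b\,dt\ (i\ge1).$$ Given $(u_i^n,c_i^n)_{i\ge1}$ with all $u_i^n>0$, set $\chi_i^n(\xi)=\chi(c_i^n,\xi)$ ($i\ge0$), $\lambda_i^n=\frac{\Delta x^n}{u_i^n\Delta t}$, and for $i\ge1$, $\xi\in(0,1)$ define $\phi_i^{n+1}(\xi)$ by $$\Delta t\,u_i^n\big(\phi_i^{n+1}(\xi)-\chi_i^n(\xi)\big)+a(\xi)\Delta x^n\big(\phi_{i+1/2}^n(\xi)-\phi_{i-1/2}^n(\xi)\big)+\Delta x^n h(c_i^n)\big(\chi_i^n(\xi)-\chi_{i-1}^n(\xi)\big)=0,$$ where $a(\xi)\phi_{i+1/2}^n(\xi)=a^+(\xi)\chi_i^n(\xi)-a^-(\xi)\chi_{i+1}^n(\xi)$ (extend by $0$ for $\xi\notin(0,1)$). Then $c_i^{n+1}=\int_{\mathbb{R}}\phi_i^{n+1}(\xi)\,d\xi$, i.e. $$c_i^{n+1}=c_i^n-\lambda_i^n\Big\{(A^+(c_i^n)-A^+(c_{i-1}^n))-(A^-(c_{i+1}^n)-A^-(c_i^n))+h(c_i^n)(c_i^n-c_{i-1}^n)\Big\},$$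 and the velocity is updated by $$u_i^{n+1}=u_i^n-\frac{\Delta x^n}{\Delta t}\big(h(c_{i+1}^n)-h(c_{i-1}^n)\big)\qquad(i\ge1).$$ The index $i$ ranges over all integers $\ge1$, and $\min_i$ is understood as $\inf_i$. *)

theory Defs
  imports "HOL-Analysis.Analysis" "HOL-Probability.Essential_Supremum"
begin

text \<open>Functions on the unit interval are represented by total functions \<open>real \<Rightarrow> real\<close> of which
  only the values on \<open>{0..1}\<close> matter; derivatives are one-sided at the end points.\<close>

definition deriv01 :: "(real \<Rightarrow> real) \<Rightarrow> real \<Rightarrow> real" where
  "deriv01 g c = vector_derivative g (at c within {0..1})"

definition continuously_differentiable01 :: "(real \<Rightarrow> real) \<Rightarrow> bool" where
  "continuously_differentiable01 g \<longleftrightarrow>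
     g differentiable_on {0..1} \<and> continuous_on {0..1} (deriv01 g)"

definition sup_norm01 :: "(real \<Rightarrow> real) \<Rightarrow> real" where
  "sup_norm01 g = (SUP c\<in>{0..1}. \<bar>g c\<bar>)"

text \<open>The norm of \<open>L\<^sup>\<infinity>(0,\<infinity>)\<close>.\<close>

definition Linf_norm :: "(real \<Rightarrow> real) \<Rightarrow> ereal" where
  "Linf_norm g = esssup (lebesgue_on {0<..}) (\<lambda>t. ereal \<bar>g t\<bar>)"

definition h_fun :: "(real \<Rightarrow> real) \<Rightarrow> (real \<Rightarrow> real) \<Rightarrow> real \<Rightarrow> real" where
  "h_fun q1 q2 c = q1 c + q2 c"

definition f_fun :: "(real \<Rightarrow> real) \<Rightarrow> (real \<Rightarrow> real) \<Rightarrow> real \<Rightarrow> real" where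
  "f_fun q1 q2 c = q1 c - c * h_fun q1 q2 c"

definition a_fun :: "(real \<Rightarrow> real) \<Rightarrow> (real \<Rightarrow> real) \<Rightarrow> real \<Rightarrow> real" where
  "a_fun q1 q2 \<xi> = 1 + deriv01 (f_fun q1 q2) \<xi>"

definition isotherms :: "(real \<Rightarrow> real) \<Rightarrow> (real \<Rightarrow> real) \<Rightarrow> bool" where
  "isotherms q1 q2 \<longleftrightarrow>
     continuously_differentiable01 q1 \<and> continuously_differentiable01 q2 \<and>
     (\<forall>c\<in>{0..1}. deriv01 q1 c \<ge> 0 \<and> 0 \<ge> deriv01 q2 c \<and> h_fun q1 q2 c \<ge> 0)"

definition pos_part :: "real \<Rightarrow> real" where "pos_part r = max r 0"

definition neg_part :: "real \<Rightarrow> real" where "neg_part r = - min r 0"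

definition chi :: "real \<Rightarrow> real \<Rightarrow> real" where
  "chi c \<xi> = (if 0 < \<xi> \<and> \<xi> < c then 1 else 0)"

text \<open>The product \<open>a(\<xi>) \<phi>\<^bsub>i+1/2\<^esub>(\<xi>)\<close>, for the states \<open>cl = c\<^sub>i\<close> and \<open>cr = c\<^bsub>i+1\<^esub>\<close>
  on either side of the interface.\<close>

definition upwind_flux ::
  "(real \<Rightarrow> real) \<Rightarrow> (real \<Rightarrow> real) \<Rightarrow> real \<Rightarrow> real \<Rightarrow> real \<Rightarrow> real" where
  "upwind_flux q1 q2 cl cr \<xi> =
     pos_part (a_fun q1 q2 \<xi>) * chi cl \<xi> - neg_part (a_fun q1 q2 \<xi>) * chi cr \<xi>"

text \<open>\<open>Te dt i\<close> has end points \<open>t\<^bsub>i-1/2\<^esub> = (i - 1) dt\<close> and \<open>t\<^bsub>i+1/2\<^esub> = i dt\<close>.\<close>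

definition Te :: "real \<Rightarrow> nat \<Rightarrow> real set" where
  "Te dt i = {(real i - 1) * dt <..< real i * dt}"

definition x_mesh :: "(nat \<Rightarrow> real) \<Rightarrow> nat \<Rightarrow> real" where
  "x_mesh dx n = (\<Sum>k<n. dx k)"

text \<open>The first index of \<open>u\<close>, \<open>c\<close>, \<open>phi\<close> is the (upper) step index, the second one the cell index:
  \<open>u n i = u\<^sub>i\<^sup>n\<close>.  The cells are the \<open>i \<ge> 1\<close>; \<open>c n 0\<close> is the boundary value, whereas \<open>u n 0\<close>,
  \<open>phi n 0\<close> and \<open>phi 0 i\<close> do not belong to the scheme and are left unspecified.  Step \<open>n\<close> is
  carried out only as long as all velocities obtained so far are positive.\<close>

definition kinetic_scheme ::
  "(real \<Rightarrow> real) \<Rightarrow> (real \<Rightarrow> real) \<Rightarrow> (real \<Rightarrow> real) \<Rightarrow> (real \<Rightarrow> real) \<Rightarrow> (real \<Rightarrow> real) \<Rightarrow>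
   real \<Rightarrow> (nat \<Rightarrow> real) \<Rightarrow> (nat \<Rightarrow> nat \<Rightarrow> real) \<Rightarrow> (nat \<Rightarrow> nat \<Rightarrow> real) \<Rightarrow>
   (nat \<Rightarrow> nat \<Rightarrow> real \<Rightarrow> real) \<Rightarrow> bool" where
  "kinetic_scheme q1 q2 cb c0 ub dt dx u c phi \<longleftrightarrow>
     (\<forall>n. c n 0 = 1 / dx n * (LINT x:{x_mesh dx n <..< x_mesh dx (Suc n)}|lebesgue. c0 x)) \<and>
     (\<forall>i\<ge>1. u 0 i = 1 / dt * (LINT t:Te dt i|lebesgue. ub t)) \<and>
     (\<forall>i\<ge>1. c 0 i = 1 / dt * (LINT t:Te dt i|lebesgue. cb t)) \<and>
     (\<forall>n. (\<forall>k\<le>n. \<forall>i\<ge>1. u k i > 0) \<longrightarrow>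
        (\<forall>i\<ge>1.
           (\<forall>\<xi>\<in>{0<..<1}.
              dt * u n i * (phi (Suc n) i \<xi> - chi (c n i) \<xi>)
              + dx n * (upwind_flux q1 q2 (c n i) (c n (i + 1)) \<xi>
                        - upwind_flux q1 q2 (c n (i - 1)) (c n i) \<xi>)
              + dx n * h_fun q1 q2 (c n i) * (chi (c n i) \<xi> - chi (c n (i - 1)) \<xi>) = 0) \<and>
           (\<forall>\<xi>. \<xi> \<notin> {0<..<1} \<longrightarrow> phi (Suc n) i \<xi> = 0) \<and>
           c (Suc n) i = (LINT \<xi>|lborel. phi (Suc n) i \<xi>) \<and>
           u (Suc n) i = u n i - dx n / dt *
             (h_fun q1 q2 (c n (i + 1)) - h_fun q1 q2 (c n (i - 1)))))"

text \<open>The relations above determine an actual computation: they have a solution for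
  arbitrary data.\<close>

lemma kinetic_scheme_exists:
  assumes dt: "dt > 0"
  shows "\<exists>u c phi. kinetic_scheme q1 q2 cb c0 ub dt dx u c phi"
proof -
  define bd where "bd n = 1 / dx n * (LINT x:{x_mesh dx n <..< x_mesh dx (Suc n)}|lebesgue. c0 x)"
    for n
  define ph where "ph n U C i \<xi> = (if \<xi> \<in> {0<..<1} then chi (C i) \<xi>
      - (dx n * (upwind_flux q1 q2 (C i) (C (i + 1)) \<xi> - upwind_flux q1 q2 (C (i - 1)) (C i) \<xi>)
         + dx n * h_fun q1 q2 (C i) * (chi (C i) \<xi> - chi (C (i - 1)) \<xi>)) / (dt * U i) else 0)"
    for n and U C :: "nat \<Rightarrow> real" and i \<xi>
  define st where "st = rec_nat
     ((\<lambda>i. 1 / dt * (LINT t:Te dt i|lebesgue. ub t)),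
      (\<lambda>i. if i = 0 then bd 0 else 1 / dt * (LINT t:Te dt i|lebesgue. cb t)))
     (\<lambda>n (U, C). ((\<lambda>i. U i - dx n / dt * (h_fun q1 q2 (C (i + 1)) - h_fun q1 q2 (C (i - 1)))),
        (\<lambda>i. if i = 0 then bd (Suc n) else (LINT \<xi>|lborel. ph n U C i \<xi>))))"
  define u where "u n = fst (st n)" for n
  define c where "c n = snd (st n)" for n
  define phi where "phi m = ph (m - 1) (u (m - 1)) (c (m - 1))" for m
  have bdry: "c n 0 = bd n" for n
    by (cases n) (simp_all add: c_def st_def case_prod_unfold)
  have uS: "u (Suc n) i = u n i - dx n / dt * (h_fun q1 q2 (c n (i + 1)) - h_fun q1 q2 (c n (i - 1)))"
    for n i by (simp add: u_def c_def st_def case_prod_unfold)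
  have cS: "c (Suc n) i = (LINT \<xi>|lborel. phi (Suc n) i \<xi>)" if "i \<ge> 1" for n i
    using that by (simp add: phi_def u_def c_def st_def case_prod_unfold)
  have ini: "u 0 i = 1 / dt * (LINT t:Te dt i|lebesgue. ub t)"
    "i \<ge> 1 \<Longrightarrow> c 0 i = 1 / dt * (LINT t:Te dt i|lebesgue. cb t)" for i
    by (simp_all add: u_def c_def st_def)
  have eq: "dt * u n i * (phi (Suc n) i \<xi> - chi (c n i) \<xi>)
      + dx n * (upwind_flux q1 q2 (c n i) (c n (i + 1)) \<xi> - upwind_flux q1 q2 (c n (i - 1)) (c n i) \<xi>)
      + dx n * h_fun q1 q2 (c n i) * (chi (c n i) \<xi> - chi (c n (i - 1)) \<xi>) = 0"
    if "u n i > 0" "\<xi> \<in> {0<..<1}" for n i \<xi>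
  proof -
    have "dt * u n i \<noteq> 0" using that dt by simp
    then show ?thesis using that(2) by (simp add: phi_def ph_def)
  qed
  have "kinetic_scheme q1 q2 cb c0 ub dt dx u c phi"
    unfolding kinetic_scheme_def
  proof (intro conjI allI impI ballI)
    show "phi (Suc n) i \<xi> = 0" if "\<xi> \<notin> {0<..<1}" for n i \<xi>
      unfolding phi_def ph_def using that by (rule if_not_P)
  qed (simp only: bdry bd_def, rule ini, rule ini, assumption, rule eq, blast, assumption,
      rule cS, assumption, rule uS)
  then show ?thesis by blast
qed

definition CFL_condition ::
  "(real \<Rightarrow> real) \<Rightarrow> (real \<Rightarrow> real) \<Rightarrow> real \<Rightarrow> real \<Rightarrow> (nat \<Rightarrow> real) \<Rightarrow> bool" where
  "CFL_condition q1 q2 dt dxn un \<longleftrightarrow>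
     (sup_norm01 (h_fun q1 q2) + 2 * sup_norm01 (a_fun q1 q2)) * dxn \<le> (INF i\<in>{1..}. un i) * dt"

end

theory Submission
  imports Defs
begin

text \<open>Each \<open>\<phi>\<^sub>i\<close> at the new step is the combination of \<open>\<chi>\<^sub>i\<close>, \<open>\<chi>\<^bsub>i+1\<^esub>\<close>, \<open>\<chi>\<^bsub>i-1\<^esub>\<close> with the weights
  \<open>1 - \<lambda> (\<bar>a\<bar> + h)\<close>, \<open>\<lambda> a\<^sup>-\<close>, \<open>\<lambda> (a\<^sup>+ + h)\<close>, which the CFL condition makes convex.  Hence
  \<open>0 \<le> \<phi>\<^sub>i \<le> 1\<close>; moreover, if all the states are at most \<open>M\<close>, then \<open>\<phi>\<^sub>i\<close> vanishes outside
  \<open>(0, M)\<close>, so that its integral, the new state, lies in \<open>[0, M]\<close> again.\<close>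

text \<open>A real \<open>SUP\<close> is an upper bound only over a bounded set; here compactness of
  the continuous image supplies boundedness.\<close>

lemma abs_le_sup_norm01:
  assumes "continuous_on {0..1} g" "\<xi> \<in> {0..1}"
  shows "\<bar>g \<xi>\<bar> \<le> sup_norm01 g"
proof -
  have "compact ((\<lambda>c. \<bar>g c\<bar>) ` {0..1})"
    using assms(1) by (intro compact_continuous_image continuous_intros) auto
  then have "bdd_above ((\<lambda>c. \<bar>g c\<bar>) ` {0..1})"
    by (intro bounded_imp_bdd_above compact_imp_bounded)
  then show ?thesis
    unfolding sup_norm01_def using assms(2) by (intro cSUP_upper)
qed

lemma has_vector_derivative_deriv01:
  assumes "g differentiable_on {0..1}" "c \<in> {0..1}"
  shows "(g has_vector_derivative deriv01 g c) (at c within {0..1})"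
  using assms by (simp add: deriv01_def differentiable_on_def flip: vector_derivative_works)

lemma deriv01_eqI:
  assumes "(g has_vector_derivative d) (at c within {0..1})" "c \<in> {0..1}"
  shows "deriv01 g c = d"
  unfolding deriv01_def using assms by (intro vector_derivative_within_closed_interval) auto

context
  fixes q1 q2 :: "real \<Rightarrow> real"
  assumes iso: "isotherms q1 q2"
begin

lemma continuous_on_h_fun: "continuous_on {0..1} (h_fun q1 q2)"
  using iso unfolding isotherms_def continuously_differentiable01_def h_fun_def
  by (intro continuous_intros differentiable_imp_continuous_on) auto

text \<open>The product rule writes the derivative through functions known to be continuous. This
  yields continuity of \<open>a_fun\<close>, so that its sup norm really bounds it.\<close>

lemma deriv01_f_fun:
  assumes "c \<in> {0..1}"
  shows "deriv01 (f_fun q1 q2) c =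
    deriv01 q1 c - (h_fun q1 q2 c + c * (deriv01 q1 c + deriv01 q2 c))"
proof -
  have q: "(q1 has_vector_derivative deriv01 q1 c) (at c within {0..1})"
      "(q2 has_vector_derivative deriv01 q2 c) (at c within {0..1})"
    using iso assms
    by (auto simp: isotherms_def continuously_differentiable01_def
        intro: has_vector_derivative_deriv01)
  have "(f_fun q1 q2 has_vector_derivative
      deriv01 q1 c - (c * (deriv01 q1 c + deriv01 q2 c) + 1 * (q1 c + q2 c))) (at c within {0..1})"
    unfolding f_fun_def h_fun_def
    by (intro has_vector_derivative_diff has_vector_derivative_mult has_vector_derivative_add
        has_vector_derivative_id q)
  from deriv01_eqI[OF this assms] show ?thesis by (simp add: h_fun_def)
qed

lemma continuous_on_a_fun: "continuous_on {0..1} (a_fun q1 q2)"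
proof -
  have "continuous_on {0..1}
      (\<lambda>c. 1 + (deriv01 q1 c - (h_fun q1 q2 c + c * (deriv01 q1 c + deriv01 q2 c))))"
    using iso continuous_on_h_fun
    by (intro continuous_intros) (auto simp: isotherms_def continuously_differentiable01_def)
  then show ?thesis
    by (rule continuous_on_eq) (simp add: a_fun_def deriv01_f_fun)
qed

lemma CFL_condition_bound:
  assumes cfl: "CFL_condition q1 q2 dt dxn un"
    and pos: "\<forall>i\<ge>1. un i > 0" and "dt > 0" "dxn > 0" "i \<ge> 1"
    and "\<xi> \<in> {0..1}" "c \<in> {0..1}"
  shows "(\<bar>a_fun q1 q2 \<xi>\<bar> + h_fun q1 q2 c) * dxn \<le> un i * dt"
proof -
  have "\<bar>a_fun q1 q2 \<xi>\<bar> \<le> sup_norm01 (a_fun q1 q2)" "\<bar>h_fun q1 q2 c\<bar> \<le> sup_norm01 (h_fun q1 q2)"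
    using assms continuous_on_a_fun continuous_on_h_fun by (auto intro: abs_le_sup_norm01)
  \<comment> \<open>The norm of \<open>a_fun\<close> dominates an absolute value, hence is
    nonnegative, and doubling it only enlarges the right-hand side.\<close>
  then have "\<bar>a_fun q1 q2 \<xi>\<bar> + h_fun q1 q2 c
      \<le> sup_norm01 (h_fun q1 q2) + 2 * sup_norm01 (a_fun q1 q2)" by linarith
  then have "(\<bar>a_fun q1 q2 \<xi>\<bar> + h_fun q1 q2 c) * dxn
      \<le> (sup_norm01 (h_fun q1 q2) + 2 * sup_norm01 (a_fun q1 q2)) * dxn"
    using \<open>dxn > 0\<close> by (intro mult_right_mono) auto
  also have "\<dots> \<le> (INF i\<in>{1..}. un i) * dt" using cfl by (simp add: CFL_condition_def)
  \<comment> \<open>Positivity of the velocities makes 0 a lower bound, without which the real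
    \<open>INF\<close> need not lie below its members.\<close>
  also have "\<dots> \<le> un i * dt"
    using pos \<open>dt > 0\<close> \<open>i \<ge> 1\<close>
    by (intro mult_right_mono cINF_lower bdd_belowI2[where m = 0]) (auto intro: less_imp_le)
  finally show ?thesis .
qed

text \<open>The bound \<open>chi M \<xi>\<close> controls range and support at once:
  \<open>chi\<close> is monotone in its state, so all three stencil values, and hence their convex
  combination, stay below it.\<close>

lemma kinetic_update_bounds:
  assumes eq: "dt * w * (p - chi cm \<xi>)
      + dxn * (upwind_flux q1 q2 cm cr \<xi> - upwind_flux q1 q2 cl cm \<xi>)
      + dxn * h_fun q1 q2 cm * (chi cm \<xi> - chi cl \<xi>) = 0"
    and cfl: "(\<bar>a_fun q1 q2 \<xi>\<bar> + h_fun q1 q2 cm) * dxn \<le> w * dt"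
    and pos: "w > 0" "dt > 0" "dxn > 0"
    and cm: "cm \<in> {0..1}" and \<xi>: "\<xi> > 0"
    and M: "cl \<le> M" "cm \<le> M" "cr \<le> M"
  shows "0 \<le> p" "p \<le> chi M \<xi>"
proof -
  define a h where "a = a_fun q1 q2 \<xi>" and "h = h_fun q1 q2 cm"
  \<comment> \<open>These are the convex weights multiplied by \<open>dt * w\<close>, which avoids
    division; they sum to \<open>dt * w\<close> instead of 1.\<close>
  define A B C where "A = dt * w - dxn * (\<bar>a\<bar> + h)"
    and "B = dxn * neg_part a" and "C = dxn * (pos_part a + h)"
  have "h \<ge> 0" using iso cm by (auto simp: isotherms_def h_def)
  then have nonneg: "A \<ge> 0" "B \<ge> 0" "C \<ge> 0"
    using cfl pos
    by (auto simp: A_def B_def C_def a_def h_def pos_part_def neg_part_def mult.commute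
        mult_nonneg_nonpos)
  have abs: "\<bar>a\<bar> = pos_part a + neg_part a" by (simp add: pos_part_def neg_part_def)
  then have total: "A + B + C = dt * w" by (simp add: A_def B_def C_def algebra_simps)
  have convex: "dt * w * p = A * chi cm \<xi> + B * chi cr \<xi> + C * chi cl \<xi>"
    using eq unfolding upwind_flux_def A_def B_def C_def abs a_def[symmetric] h_def[symmetric]
    by (simp add: algebra_simps)
  have chi0: "0 \<le> chi z \<xi>" for z by (simp add: chi_def)
  have chiM: "chi z \<xi> \<le> chi M \<xi>" if "z \<le> M" for z using that by (simp add: chi_def)
  have dw: "dt * w > 0" using pos by simp
  have "0 \<le> dt * w * p" unfolding convex using nonneg chi0 by simp
  then show "0 \<le> p" using dw by (simp add: zero_le_mult_iff)
  have "dt * w * p \<le> A * chi M \<xi> + B * chi M \<xi> + C * chi M \<xi>"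
    unfolding convex using nonneg M by (intro add_mono mult_left_mono chiM)
  also have "\<dots> = dt * w * chi M \<xi>" by (simp flip: total add: algebra_simps)
  finally show "p \<le> chi M \<xi>" using dw by (simp add: mult_le_cancel_left_pos)
qed

end

text \<open>Measurability of \<open>p\<close> is not at issue: a non-integrable function has
  integral 0 by convention, which lies in \<open>[0, M]\<close>. Otherwise compare with the
  indicator of \<open>(0, M)\<close>.\<close>

lemma integral_chi_bounds:
  assumes "\<And>\<xi>. 0 \<le> p \<xi>" "\<And>\<xi>. p \<xi> \<le> chi M \<xi>" "0 \<le> M"
  shows "0 \<le> (LINT \<xi>|lborel. p \<xi>)" "(LINT \<xi>|lborel. p \<xi>) \<le> M"
proof -
  show "0 \<le> (LINT \<xi>|lborel. p \<xi>)" using assms(1) by simp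
  have chi: "chi M = indicator {0<..<M}"
    by (auto simp: chi_def indicator_def fun_eq_iff)
  have int: "integrable lborel (indicator {0<..<M} :: real \<Rightarrow> real)"
    using \<open>0 \<le> M\<close> by (intro integrable_real_indicator) auto
  have "(LINT \<xi>|lborel. p \<xi>) \<le> (LINT \<xi>|lborel. indicator {0<..<M} \<xi>)"
    using assms(1,2) int by (intro integral_mono') (auto simp: chi)
  also have "\<dots> = M" using \<open>0 \<le> M\<close> by simp
  finally show "(LINT \<xi>|lborel. p \<xi>) \<le> M" .
qed

text \<open>The half-line must have nonzero measure, since over a null space the essential supremum
  is \<open>-\<infinity>\<close>.\<close>

lemma Linf_norm_nonneg: "0 \<le> Linf_norm g"
proof -
  have "emeasure (lebesgue_on {0<..}) (space (lebesgue_on {0::real<..})) \<noteq> 0"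
  proof -
    have "ennreal 1 = emeasure lborel {0::real<..<1}" by simp
    also have "\<dots> \<le> emeasure lborel {0::real<..}" by (intro emeasure_mono) auto
    also have "\<dots> = emeasure lebesgue {0::real<..}" by simp
    finally show ?thesis by (auto simp: emeasure_restrict_space)
  qed
  then have "0 = esssup (lebesgue_on {0<..}) (\<lambda>t::real. 0 :: ereal)"
    by (simp add: esssup_const)
  also have "\<dots> \<le> Linf_norm g" unfolding Linf_norm_def by (rule esssup_mono) auto
  finally show ?thesis .
qed

lemma Linf_norm_le:
  assumes "g \<in> borel_measurable (lebesgue_on {0<..})" "\<And>t. t > 0 \<Longrightarrow> \<bar>g t\<bar> \<le> K"
  shows "Linf_norm g \<le> ereal K"
  unfolding Linf_norm_def using assms
  by (intro esssup_I) (auto simp: space_restrict_space intro!: AE_I2)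

lemma AE_le_Linf_norm: "AE t in lebesgue. t > 0 \<longrightarrow> ereal \<bar>g t\<bar> \<le> Linf_norm g"
proof -
  have "AE t in lebesgue_on {0<..}. ereal \<bar>g t\<bar> \<le> Linf_norm g"
    unfolding Linf_norm_def by (rule esssup_AE)
  then show ?thesis by (simp add: AE_restrict_space_iff)
qed

text \<open>Serves both the time cells of \<open>cb\<close> and the space cells of
  \<open>c0\<close>. The norm bounds \<open>g\<close> only almost everywhere, so the integrals are
  compared through an AE inequality; \<open>0 \<le> M\<close> also covers the default integral
  0.\<close>

lemma average_bounds:
  fixes g :: "real \<Rightarrow> real"
  assumes nonneg: "\<And>t. t > 0 \<Longrightarrow> 0 \<le> g t"
    and M: "Linf_norm g \<le> ereal M" "0 \<le> M"
    and ivl: "0 \<le> a" "d > 0" "b = a + d"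
  shows "0 \<le> 1 / d * (LINT t:{a<..<b}|lebesgue. g t)"
    and "1 / d * (LINT t:{a<..<b}|lebesgue. g t) \<le> M"
proof -
  show "0 \<le> 1 / d * (LINT t:{a<..<b}|lebesgue. g t)"
    using nonneg ivl
    by (auto simp: set_lebesgue_integral_def indicator_def
        intro!: Bochner_Integration.integral_nonneg divide_nonneg_pos)
  have "AE t in lebesgue. indicator {a<..<b} t *\<^sub>R g t \<le> indicator {a<..<b} t *\<^sub>R M"
    using AE_le_Linf_norm[of g]
  proof eventually_elim
    case (elim t)
    show ?case
    proof (cases "t \<in> {a<..<b}")
      case True
      then have "ereal \<bar>g t\<bar> \<le> ereal M" using elim M(1) ivl(1)
        by (meson greaterThanLessThan_iff le_less_trans order_trans)
      then show ?thesis using True by simp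
    qed simp
  qed
  moreover have "integrable lebesgue (\<lambda>t. indicator {a<..<b} t *\<^sub>R M)"
    using ivl by (intro integrable_scaleR_left integrable_real_indicator) auto
  ultimately have "(LINT t:{a<..<b}|lebesgue. g t) \<le> (LINT t|lebesgue. indicator {a<..<b} t *\<^sub>R M)"
    unfolding set_lebesgue_integral_def using M(2) by (intro integral_mono_AE') auto
  also have "\<dots> = d * M" using ivl by simp
  finally show "1 / d * (LINT t:{a<..<b}|lebesgue. g t) \<le> M"
    using ivl by (simp add: field_simps)
qed

theorem proposition5p1:
  fixes q1 q2 cb c0 ub :: "real \<Rightarrow> real"
    and \<alpha> dt :: real
    and dx :: "nat \<Rightarrow> real"
    and u c :: "nat \<Rightarrow> nat \<Rightarrow> real"
    and phi :: "nat \<Rightarrow> nat \<Rightarrow> real \<Rightarrow> real"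
    and n :: nat
  assumes "isotherms q1 q2"
    and "cb \<in> borel_measurable (lebesgue_on {0<..})" and "\<forall>t>0. cb t \<in> {0..1}"
    and "c0 \<in> borel_measurable (lebesgue_on {0<..})" and "\<forall>x>0. c0 x \<in> {0..1}"
    and "ub \<in> borel_measurable (lebesgue_on {0<..})" and "bounded (ub ` {0<..})"
    and "\<alpha> > 0" and "\<forall>t>0. ub t \<ge> \<alpha>"
    and "dt > 0" and "\<forall>k. dx k > 0"
    and "kinetic_scheme q1 q2 cb c0 ub dt dx u c phi"
    and "\<forall>k\<le>n. \<forall>i\<ge>1. u k i > 0"
    and "\<forall>k\<le>n. CFL_condition q1 q2 dt (dx k) (u k)"
  shows "(\<forall>k i \<xi>. 1 \<le> k \<and> k \<le> n + 1 \<and> 1 \<le> i \<longrightarrow> 0 \<le> phi k i \<xi> \<and> phi k i \<xi> \<le> 1) \<and>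
         (\<forall>k i. k \<le> n + 1 \<longrightarrow>
            0 \<le> c k i \<and> ereal (c k i) \<le> max (Linf_norm cb) (Linf_norm c0)) \<and>
         max (Linf_norm cb) (Linf_norm c0) \<le> 1"
proof -
  define N where "N = max (Linf_norm cb) (Linf_norm c0)"
  have "0 \<le> N" unfolding N_def by (simp add: Linf_norm_nonneg le_max_iff_disj)
  have "N \<le> 1" unfolding N_def one_ereal_def using assms(2-5) by (auto intro!: Linf_norm_le)
  \<comment> \<open>The extended-real maximum is finite, so all estimates can be run with a real
    bound \<open>M\<close>.\<close>
  with \<open>0 \<le> N\<close> obtain M where N: "N = ereal M" by (cases N) auto
  have M: "0 \<le> M" "M \<le> 1" using \<open>0 \<le> N\<close> \<open>N \<le> 1\<close> N by auto
  have norms: "Linf_norm cb \<le> ereal M" "Linf_norm c0 \<le> ereal M" unfolding N[symmetric] N_def by auto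
  note scheme = assms(12)[unfolded kinetic_scheme_def]
  have bdry: "0 \<le> c k 0 \<and> c k 0 \<le> M" for k
  proof -
    have "c k 0 = 1 / dx k * (LINT x:{x_mesh dx k <..< x_mesh dx (Suc k)}|lebesgue. c0 x)"
      using scheme by blast
    moreover have "0 \<le> x_mesh dx k"
      unfolding x_mesh_def using assms(11) by (intro sum_nonneg) (simp add: less_imp_le)
    moreover have "x_mesh dx (Suc k) = x_mesh dx k + dx k"
      by (simp add: x_mesh_def)
    ultimately show ?thesis using average_bounds[of c0 M] assms(5,11) norms M by simp
  qed
  have init: "0 \<le> c 0 i \<and> c 0 i \<le> M" if "i \<ge> 1" for i
  proof -
    have "c 0 i = 1 / dt * (LINT t:Te dt i|lebesgue. cb t)"
      using scheme that by blast
    moreover have "0 \<le> (real i - 1) * dt" "real i * dt = (real i - 1) * dt + dt"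
      using assms(10) that by (auto simp: algebra_simps)
    ultimately show ?thesis
      using average_bounds[of cb M] assms(3,10) norms M unfolding Te_def by simp
  qed
  \<comment> \<open>One step of the scheme: bounds on all states at level \<open>k\<close>,
    including the boundary cell reached when \<open>i = 1\<close>, control the kinetic function at
    level \<open>Suc k\<close>.\<close>
  have phi: "0 \<le> phi (Suc k) i \<xi> \<and> phi (Suc k) i \<xi> \<le> chi M \<xi>"
    if k: "k \<le> n" and i: "i \<ge> 1" and c: "\<And>j. 0 \<le> c k j \<and> c k j \<le> M" for k i \<xi>
  proof (cases "\<xi> \<in> {0<..<1}")
    case False
    then have "phi (Suc k) i \<xi> = 0" using scheme k i assms(13) by (meson order_trans)
    then show ?thesis by (simp add: chi_def)
  next
    case True
    \<comment> \<open>Here \<open>M \<le> 1\<close> matters: the sign of \<open>h_fun\<close> and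
      the sup norms are available only on the unit interval.\<close>
    have c1: "c k i \<in> {0..1}" using c[of i] M by auto
    have eq: "dt * u k i * (phi (Suc k) i \<xi> - chi (c k i) \<xi>)
        + dx k * (upwind_flux q1 q2 (c k i) (c k (i + 1)) \<xi>
                  - upwind_flux q1 q2 (c k (i - 1)) (c k i) \<xi>)
        + dx k * h_fun q1 q2 (c k i) * (chi (c k i) \<xi> - chi (c k (i - 1)) \<xi>) = 0"
      using scheme True k i assms(13) by (meson order_trans)
    have "(\<bar>a_fun q1 q2 \<xi>\<bar> + h_fun q1 q2 (c k i)) * dx k \<le> u k i * dt"
      using assms(10,11,13,14) k i True c1
      by (intro CFL_condition_bound[OF assms(1)]) auto
    from kinetic_update_bounds[OF assms(1) eq this, of M] show ?thesis
      using assms(10,11,13) True c c1 k i by simp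
  qed
  have c: "0 \<le> c k i \<and> c k i \<le> M" if "k \<le> n + 1" for k i
    using that
  \<comment> \<open>The cell index is generalized because the update uses both neighbours. Cell 0 is
    not updated by the scheme but is covered by \<open>bdry\<close> at every level.\<close>
  proof (induction k arbitrary: i)
    case 0
    then show ?case using bdry init by (cases "i = 0") auto
  next
    case (Suc k)
    show ?case
    proof (cases "i = 0")
      case False
      then have "i \<ge> 1" by simp
      then have "c (Suc k) i = (LINT \<xi>|lborel. phi (Suc k) i \<xi>)"
        using scheme Suc.prems assms(13) by (metis Suc_eq_plus1 Suc_le_mono order_trans)
      then show ?thesis
        using integral_chi_bounds[of "phi (Suc k) i" M] phi[OF _ \<open>i \<ge> 1\<close> Suc.IH] Suc.prems M by simp
    qed (use bdry in simp)
  qed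
  have "0 \<le> phi k i \<xi> \<and> phi k i \<xi> \<le> 1" if "1 \<le> k" "k \<le> n + 1" "1 \<le> i" for k i \<xi>
  proof -
    \<comment> \<open>Level \<open>k\<close> of \<open>phi\<close> is computed from the states at
      level \<open>k - 1\<close>, where positivity and the CFL condition are assumed.\<close>
    obtain k' where k': "k = Suc k'" "k' \<le> n" using \<open>1 \<le> k\<close> \<open>k \<le> n + 1\<close> by (cases k) auto
    have "chi M \<xi> \<le> 1" by (simp add: chi_def)
    then show ?thesis using phi[OF k'(2) \<open>1 \<le> i\<close> c, of \<xi>] k' by auto
  qed
  then show ?thesis using c \<open>N \<le> 1\<close> N unfolding N_def by auto
qed

end
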